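(* Let $X$ be (the vertex set of) a nonoriented graph with natural distance $d$, let $A\subseteq X$, let $d_A$ be the restriction of $d$ to $A\times A$, and let $d_0^A:=\min\{d_A(x,y): x,y\in A,\ x\neq y\}$. If $d_0^A=1$, then every contractive map from $(A,d_A)$ to itself is constant if and only if $A$ is a connected subgraph. In particular (case $A=X$, with $d_0^X=1$), there are no nonconstant contractive maps from $(X,d)$ to itself if and only if $X$ is a connected graph.
   Context: A graph is a (finite or infinite) set of vertices together with a set of ordered pairs of vertices, called edges; it is nonoriented if whenever $(x,y)$ is an edge, $(y,x)$ is an edge. The natural distance $d(x,y)$ is the minimum number of edges in a path from $x$ to $y$, and $d(x,y)=\infty$ if there is no such path. A graph is connected if any two vertices are joined by a path of finite length. A subset $A$ of vertices is regarded as the subgraph whose edges are the edges of the graph with both endpoints in $A$; it is a connected subgraph if any two vertices of $A$ are joined by a finite path all of whose vertices lie in $A$. Distances may take the value $\infty$. A map $f$ from a metric space $(Y,\rho)$ to itself is contractive if $\rho(f(x),f(y))<\rho(x,y)$ for all $x,y\in Y$ with $x\neq y$. *)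

theory Defs
  imports "Graph_Theory.Graph_Theory" "HOL-Library.Extended_Nat"
    "HOL-Analysis.Abstract_Topology_2"
begin

text \<open>
  Graphs are the library's \<^typ>\<open>'a pair_pre_digraph\<close> (a vertex set together with a set of ordered
  pairs of vertices, possibly infinite, loops allowed). The locale \<^locale>\<open>pair_sym_digraph\<close>
  says that the endpoints of edges are vertices and that the graph is nonoriented.
  Paths are the library's arc walks.
\<close>

text \<open>
  On \<^typ>\<open>enat\<close>, an infimum over a nonempty set is attained, and the infimum over the
  empty set is \<^term>\<open>\<infinity> :: enat\<close>. So \<open>INF\<close> is the minimum here, with value infinity when
  there is nothing to minimise over.
\<close>

definition natural_dist :: "'a pair_pre_digraph \<Rightarrow> 'a \<Rightarrow> 'a \<Rightarrow> enat" where
  "natural_dist G x y = (INF p \<in> {p. pre_digraph.awalk G x p y}. enat (length p))"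

definition min_dist_on :: "'a set \<Rightarrow> ('a \<Rightarrow> 'a \<Rightarrow> enat) \<Rightarrow> enat" where
  "min_dist_on A \<rho> = Inf {\<rho> x y | x y. x \<in> A \<and> y \<in> A \<and> x \<noteq> y}"

definition connected_graph :: "'a pair_pre_digraph \<Rightarrow> bool" where
  "connected_graph G \<longleftrightarrow>
     (\<forall>x \<in> pverts G. \<forall>y \<in> pverts G. \<exists>p. pre_digraph.awalk G x p y)"

definition connected_subgraph :: "'a pair_pre_digraph \<Rightarrow> 'a set \<Rightarrow> bool" where
  "connected_subgraph G A \<longleftrightarrow>
     (\<forall>x \<in> A. \<forall>y \<in> A. \<exists>p. pre_digraph.awalk G x p y \<and>
        set (pre_digraph.awalk_verts G x p) \<subseteq> A)"

text \<open>
  Only the values of \<open>f\<close> and \<open>\<rho>\<close> on \<open>Y\<close> matter, so \<open>\<rho>\<close> need not be restricted explicitly.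
\<close>

definition contractive_map :: "'a set \<Rightarrow> ('a \<Rightarrow> 'a \<Rightarrow> enat) \<Rightarrow> ('a \<Rightarrow> 'a) \<Rightarrow> bool" where
  "contractive_map Y \<rho> f \<longleftrightarrow>
     f \<in> Y \<rightarrow> Y \<and> (\<forall>x \<in> Y. \<forall>y \<in> Y. x \<noteq> y \<longrightarrow> \<rho> (f x) (f y) < \<rho> x y)"

text \<open>
  Up to the empty set, which the library does not count as connected, these notions agree
  with the library's connectedness of the (induced sub)graph.
\<close>

lemma connected_subgraph_iff:
  assumes "pair_sym_digraph G" "A \<subseteq> pverts G"
  shows "connected_subgraph G A \<longleftrightarrow> A = {} \<or> Digraph_Component.connected (G \<restriction> A)"
proof -
  interpret pair_sym_digraph G by fact
  interpret H: wf_digraph "G \<restriction> A"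
    by unfold_locales auto
  have sym: "symmetric (G \<restriction> A)"
    using sym_arcs unfolding symmetric_conv by auto
  have cas: "pre_digraph.cas (G \<restriction> A) u p v \<longleftrightarrow> pcas u p v" for u p v
    by (induction p arbitrary: u) (auto simp: pre_digraph.cas.simps)
  have awalk: "H.awalk x p y \<longleftrightarrow> awalk x p y \<and> set (pawalk_verts x p) \<subseteq> A"
    for x p y
  proof -
    have "pcas x p y \<Longrightarrow>
      x \<in> A \<and> (\<forall>e \<in> set p. fst e \<in> A \<and> snd e \<in> A) \<longleftrightarrow> set (pawalk_verts x p) \<subseteq> A"
    proof (induction p arbitrary: x)
      case (Cons e p)
      then have "fst e = x" "pcas (snd e) p y"
        by auto
      with Cons.IH[of "snd e"] show ?case
        by auto
    qed simp
    then show ?thesis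
      using assms(2) unfolding H.awalk_def awalk_def cas by auto
  qed
  have "Digraph_Component.connected (G \<restriction> A) \<longleftrightarrow>
      A \<noteq> {} \<and> (\<forall>x \<in> A. \<forall>y \<in> A. \<exists>p. H.awalk x p y)"
    unfolding connected_def strongly_connected_def
    by (simp add: H.reachable_mk_symmetric_eq[OF sym] H.reachable_awalk)
  then show ?thesis
    unfolding connected_subgraph_def awalk by auto
qed

lemma connected_graph_iff:
  assumes "pair_sym_digraph G"
  shows "connected_graph G \<longleftrightarrow> pverts G = {} \<or> Digraph_Component.connected G"
proof -
  interpret pair_sym_digraph G by fact
  show ?thesis
    unfolding connected_graph_def Digraph_Component.connected_def strongly_connected_def
    by (auto simp add: reachable_mk_symmetric_eq[OF sym_arcs] reachable_awalk)
qed

end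

theory Submission
  imports Defs
begin

text \<open>
  On a graph, contractivity forces the endpoints of every edge to have the same image, hence
  a contractive map is constant along walks. If \<open>A\<close> is disconnected, mapping one component of
  \<open>A\<close> to \<open>a\<close> and the rest to \<open>b\<close>, where \<open>a\<close> and \<open>b\<close> are adjacent, is contractive, because
  vertices in different components are at distance at least 2.
\<close>

context pair_wf_digraph
begin

text \<open>A finite bound excludes the value \<open>\<infinity>\<close> of an empty infimum, so
  some walk realises it. All later facts on distances 0 and 1 reduce to this.\<close>

lemma natural_dist_le_enat_iff:
  "natural_dist G x y \<le> enat n \<longleftrightarrow> (\<exists>p. awalk x p y \<and> length p \<le> n)"
proof
  assume "natural_dist G x y \<le> enat n"
  then have "natural_dist G x y < enat (Suc n)"
    using le_less_trans by fastforce
  then show "\<exists>p. awalk x p y \<and> length p \<le> n"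
    unfolding natural_dist_def by (auto simp: Inf_less_iff)
next
  assume "\<exists>p. awalk x p y \<and> length p \<le> n"
  then show "natural_dist G x y \<le> enat n"
    unfolding natural_dist_def by (auto intro: INF_lower2)
qed

text \<open>The only walk of length 0 is \<open>[]\<close>, which is a walk only at a vertex of
  \<open>G\<close>: off the vertex set even \<open>natural_dist G x x\<close> is
  \<open>\<infinity>\<close>.\<close>

lemma natural_dist_eq_0_iff:
  "natural_dist G x y = 0 \<longleftrightarrow> x \<in> pverts G \<and> x = y"
  using natural_dist_le_enat_iff[of x y 0]
  by (auto simp: awalk_Nil_iff zero_enat_def[symmetric])

lemma natural_dist_le_1_iff:
  "natural_dist G x y \<le> 1 \<longleftrightarrow> x \<in> pverts G \<and> x = y \<or> (x, y) \<in> parcs G"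
proof -
  have "(\<exists>p. awalk x p y \<and> length p \<le> 1) \<longleftrightarrow>
      awalk x [] y \<or> (\<exists>e. awalk x [e] y)"
    by (auto simp: le_Suc_eq length_Suc_conv)
  also have "\<dots> \<longleftrightarrow> x \<in> pverts G \<and> x = y \<or> (x, y) \<in> parcs G"
    by (auto simp: awalk_Nil_iff awalk_Cons_iff dest: in_arcsD2)
  finally show ?thesis
    using natural_dist_le_enat_iff[of x y 1] by (simp add: one_enat_def)
qed

text \<open>Distances are integers, so a distance strictly below 1 is 0.\<close>

lemma contractive_map_eq_on_arc:
  assumes f: "contractive_map A (natural_dist G) f"
    and xy: "x \<in> A" "y \<in> A" "(x, y) \<in> parcs G"
  shows "f x = f y"
proof (rule ccontr)
  assume ne: "f x \<noteq> f y"
  \<comment> \<open>The arc may be a loop, but \<open>ne\<close> forces \<open>x \<noteq> y\<close>,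
    as contractivity requires.\<close>
  then have "natural_dist G (f x) (f y) < natural_dist G x y"
    using f xy unfolding contractive_map_def by auto
  moreover have "natural_dist G x y \<le> 1"
    using xy by (simp add: natural_dist_le_1_iff)
  ultimately have "natural_dist G (f x) (f y) < 1"
    by (rule less_le_trans)
  then have "natural_dist G (f x) (f y) = 0"
    by (simp only: one_eSuc iless_eSuc0)
  then show False
    using ne by (simp add: natural_dist_eq_0_iff)
qed

lemma contractive_map_eq_on_awalk:
  assumes f: "contractive_map A (natural_dist G) f"
    and "awalk x p y" "set (awalk_verts x p) \<subseteq> A"
  shows "f x = f y"
  using assms(2,3)
proof (induction p arbitrary: x)
  case Nil
  then show ?case by (simp add: awalk_Nil_iff)
next
  case (Cons e p)
  then have e: "fst e = x" "e \<in> parcs G" and p: "awalk (snd e) p y"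
    by (auto simp: awalk_Cons_iff)
  have "set (awalk_verts (snd e) p) \<subseteq> A" "x \<in> A"
    using Cons.prems e by auto
  \<comment> \<open>\<open>awalk_verts\<close> ignores its start vertex on a nonempty list, hence
    the case split: \<open>snd e\<close> is the vertex of the empty walk or the tail of the first
    arc of \<open>p\<close>.\<close>
  moreover from this have "snd e \<in> A"
    using p by (cases p) (auto simp: awalk_Cons_iff)
  ultimately show ?case
    using contractive_map_eq_on_arc[OF f, of x "snd e"] Cons.IH[OF p] e by auto
qed

lemma min_dist_on_eq_1D:
  assumes "min_dist_on A (natural_dist G) = 1"
  obtains a b where "a \<in> A" "b \<in> A" "a \<noteq> b" "(a, b) \<in> parcs G"
proof -
  let ?D = "{natural_dist G x y | x y. x \<in> A \<and> y \<in> A \<and> x \<noteq> y}"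
  \<comment> \<open>A strict bound on the infimum yields a member of \<open>?D\<close> below 2: a
    pair of distinct points at distance at most 1, hence adjacent.\<close>
  have "Inf ?D < 2"
    using assms unfolding min_dist_on_def by simp
  then obtain a b where ab: "a \<in> A" "b \<in> A" "a \<noteq> b" "natural_dist G a b < 2"
    unfolding Inf_less_iff by blast
  then have "natural_dist G a b \<le> 1"
    by (cases "natural_dist G a b") (auto simp: numeral_eq_enat one_enat_def)
  with ab that show thesis
    by (auto simp: natural_dist_le_1_iff)
qed

end

lemma (in pair_sym_digraph) contractive_maps_constant_iff:
  assumes A: "A \<subseteq> pverts G" and min: "min_dist_on A (natural_dist G) = 1"
  shows "(\<forall>f. contractive_map A (natural_dist G) f \<longrightarrow> f constant_on A)
    \<longleftrightarrow> connected_subgraph G A"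
proof
  assume "connected_subgraph G A"
  then have "f x = f y"
    if "contractive_map A (natural_dist G) f" "x \<in> A" "y \<in> A" for f x y
    using that contractive_map_eq_on_awalk
    unfolding connected_subgraph_def awalk_verts_with_proj_eq by blast
  then show "\<forall>f. contractive_map A (natural_dist G) f \<longrightarrow> f constant_on A"
    unfolding constant_on_def by metis
next
  assume const: "\<forall>f. contractive_map A (natural_dist G) f \<longrightarrow> f constant_on A"
  show "connected_subgraph G A"
  proof (rule ccontr)
    assume "\<not> connected_subgraph G A"
    then obtain x y where x: "x \<in> A" and y: "y \<in> A"
      and no_walk: "\<nexists>p. awalk x p y \<and> set (awalk_verts x p) \<subseteq> A"
      unfolding connected_subgraph_def awalk_verts_with_proj_eq by blast
    \<comment> \<open>The component of \<open>x\<close> inside \<open>A\<close>: walks through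
      vertices outside \<open>A\<close> do not count.\<close>
    define C where "C = {z. \<exists>p. awalk x p z \<and> set (awalk_verts x p) \<subseteq> A}"
    have "x \<in> C"
      using x A unfolding C_def by (auto intro!: exI[of _ "[]"] simp: awalk_Nil_iff)
    have "y \<notin> C"
      using no_walk unfolding C_def by blast
    have C_step: "v \<in> C" if "u \<in> C" "v \<in> A" "(u, v) \<in> parcs G" for u v
    proof -
      obtain p where p: "awalk x p u" "set (awalk_verts x p) \<subseteq> A"
        using \<open>u \<in> C\<close> unfolding C_def by blast
      have "awalk u [(u, v)] v"
        using that A by (auto simp: awalk_Cons_iff awalk_Nil_iff)
      then have "awalk x (p @ [(u, v)]) v"
        using p by auto
      then show ?thesis
        using p that unfolding C_def by (auto intro!: exI[of _ "p @ [(u, v)]"]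
            simp: awalk_verts_append)
    qed
    \<comment> \<open>As \<open>G\<close> is nonoriented, \<open>C_step\<close> applies in both
      directions, so no edge within \<open>A\<close> leaves or enters \<open>C\<close>.\<close>
    have C_closed: "u \<in> C \<longleftrightarrow> v \<in> C" if "u \<in> A" "v \<in> A" "(u, v) \<in> parcs G" for u v
      using C_step[of u v] C_step[of v u] that arcs_symmetric by blast
    obtain a b where ab: "a \<in> A" "b \<in> A" "a \<noteq> b" "(a, b) \<in> parcs G"
      using min_dist_on_eq_1D[OF min] .
    define f where "f z = (if z \<in> C then a else b)" for z
    have "natural_dist G (f u) (f v) < natural_dist G u v"
      if uv: "u \<in> A" "v \<in> A" "u \<noteq> v" for u v
    proof (cases "u \<in> C \<longleftrightarrow> v \<in> C")
      case True
      then have "natural_dist G (f u) (f v) = 0"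
        using ab A unfolding f_def by (auto simp: natural_dist_eq_0_iff)
      moreover have "natural_dist G u v \<noteq> 0"
        using uv by (simp add: natural_dist_eq_0_iff)
      ultimately show ?thesis by simp
    next
      case False
      then have "natural_dist G (f u) (f v) \<le> 1"
        using ab arcs_symmetric unfolding f_def by (auto simp: natural_dist_le_1_iff)
      \<comment> \<open>The distance is taken in \<open>G\<close>, so \<open>u\<close> and
        \<open>v\<close> may be joined outside \<open>A\<close>; but they are distinct and, by
        \<open>C_closed\<close>, not adjacent.\<close>
      also have "1 < natural_dist G u v"
        using False C_closed[of u v] uv by (auto simp: natural_dist_le_1_iff not_le[symmetric])
      finally show ?thesis .
    qed
    then have "contractive_map A (natural_dist G) f"
      using ab unfolding contractive_map_def by (auto simp: f_def)
    then have "f x = f y"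
      using const x y unfolding constant_on_def by metis
    then show False
      using \<open>x \<in> C\<close> \<open>y \<notin> C\<close> ab by (simp add: f_def)
  qed
qed

text \<open>Walks visit only vertices of \<open>G\<close>, so for the full vertex set the
  containment condition always holds. This turns the case \<open>A = pverts G\<close> into the
  second claim.\<close>

lemma (in pair_wf_digraph) connected_subgraph_pverts_iff:
  "connected_subgraph G (pverts G) \<longleftrightarrow> connected_graph G"
proof -
  have "set (awalk_verts x p) \<subseteq> pverts G" if "awalk x p y" for x p y
    using that by (auto elim: awalkE)
  then show ?thesis
    unfolding connected_subgraph_def awalk_verts_with_proj_eq connected_graph_def by blast
qed

theorem mainTheorem2:
  fixes G :: "'a pair_pre_digraph" and A :: "'a set"
  assumes "pair_sym_digraph G" and "A \<subseteq> pverts G"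
  shows "(min_dist_on A (natural_dist G) = 1 \<longrightarrow>
            ((\<forall>f. contractive_map A (natural_dist G) f \<longrightarrow> f constant_on A)
             \<longleftrightarrow> connected_subgraph G A))
       \<and> (min_dist_on (pverts G) (natural_dist G) = 1 \<longrightarrow>
            (\<not> (\<exists>f. contractive_map (pverts G) (natural_dist G) f \<and> \<not> f constant_on (pverts G))
             \<longleftrightarrow> connected_graph G))"
proof -
  interpret pair_sym_digraph G by fact
  show ?thesis
    using contractive_maps_constant_iff[OF assms(2)]
      contractive_maps_constant_iff[OF subset_refl] connected_subgraph_pverts_iff
    by auto
qed

end
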